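(* Let $F\in\{\widehat{\mathcal T},\widehat{\mathcal T}_{\rm lin}\}$, let $\{w^j\}_{j\ge0}\subset\mathbb R^n\times\mathbb R^m$ be any sequence, and define $\hat w^j=(\hat x^j,\hat y^j):=F(w^j)$. Assume that $w^j\to w^\star$ and $\hat w^j\to w^\star$ for some $w^\star=(x^\star,y^\star)\in W^\star$. Assume further that $g$ is partly smooth at $x^\star$ relative to a $C^2$-manifold $\mathcal M_g(x^\star)$ and that the nondegeneracy condition $$A^\top y^\star-\nabla f(x^\star)\in\operatorname{ri}\partial g(x^\star)$$ holds. Then there exists an integer $J_{\rm id}\ge0$ such that $\hat x^j\in\mathcal M_g(x^\star)$ for all $j\ge J_{\rm id}$.
   Context: Setting: $A\in\mathbb R^{m\times n}$, $b\in\mathbb R^m$, $\sigma\ge0$; $f:\mathbb R^n\to\mathbb R$ is convex and continuously differentiable with Lipschitz continuous gradient; $g:\mathbb R^n\to(-\infty,+\infty]$ is proper, closed and convex; $\Phi:=f+g$; $P\in\mathbb R^{n\times n}$, $Q\in\mathbb R^{m\times m}$ are self-adjoint positive semidefinite. Define $$\mathcal M=\begin{pmatrix} P & A^\top \\ A & Q \end{pmatrix},\qquad \mathcal T(x,y)=\begin{pmatrix} \nabla f(x)+\partial g(x)-A^\top y+\sigma A^\top(Ax-b) \\ Ax-b \end{pmatrix},\qquad W^\star:=\mathcal T^{-1}(0).$$ Exact map: $\widehat{\mathcal T}:=(\mathcal M+\mathcal T)^{-1}\mathcal M$, considered under the assumptions $Q\succ0$, $\mathcal M\succeq0$, and that $\partial\Phi+P+\sigma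 A^\top A$ has a single-valued globally Lipschitz inverse on $\mathbb R^n$ (then $\widehat{\mathcal T}$ is single-valued with full domain). Linearized map: $h:\mathbb R^n\to\mathbb R$ is convex and continuously differentiable with $L_h$-Lipschitz gradient, $f-h+\frac\sigma2\|A\cdot-b\|^2$ is convex, $Q\succ0$, $P-A^\top Q^{-1}A\succ0$; with $\mathcal B_h(x,y)=(\nabla h(x),0)$ and $\mathcal A_h:=\mathcal T-\mathcal B_h$, $\widehat{\mathcal T}_{\rm lin}(w):=(\mathcal M+\mathcal A_h)^{-1}(\mathcal Mw-\mathcal B_h(w))$ (single-valued with full domain). Partial smoothness: $g$ is partly smooth at $x^\star\in\operatorname{dom}g$ relative to a $C^2$ embedded manifold $\mathcal M_g(x^\star)\ni x^\star$ if, locally around $x^\star$, the restriction of $g$ to $\mathcal M_g(x^\star)$ is $C^2$; the tangent space satisfies $T_{\mathcal M_g(x^\star)}(x^\star)=\operatorname{par}(\partial g(x^\star))^\perp$, where $\operatorname{par}S=\operatorname{span}(S-S)$; and the set-valued map $\partial g$ is continuous at $x^\star$ along $\mathcal M_g(x^\star)$ in the Painlevé–Kuratowski sense. $\operatorname{ri}$ denotes relative interior. *)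

theory Defs
  imports "HOL-Analysis.Analysis"
begin

section \<open>Convex analysis\<close>

definition grad :: "('a::real_inner \<Rightarrow> real) \<Rightarrow> 'a \<Rightarrow> 'a" where
  "grad f x = (THE D. GDERIV f x :> D)"

definition C1_lipschitz_grad :: "real \<Rightarrow> ('a::real_inner \<Rightarrow> real) \<Rightarrow> bool" where
  "C1_lipschitz_grad L f \<longleftrightarrow>
     (\<forall>x. f differentiable (at x)) \<and> continuous_on UNIV (grad f) \<and> L-lipschitz_on UNIV (grad f)"

definition edom :: "('a \<Rightarrow> ereal) \<Rightarrow> 'a set" where
  "edom g = {x. g x < \<infinity>}"

definition epi :: "('a \<Rightarrow> ereal) \<Rightarrow> ('a \<times> real) set" where
  "epi g = {(x, r). g x \<le> ereal r}"

definition proper_closed_convex :: "('a::euclidean_space \<Rightarrow> ereal) \<Rightarrow> bool" where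
  "proper_closed_convex g \<longleftrightarrow>
     (\<forall>x. g x \<noteq> -\<infinity>) \<and> edom g \<noteq> {} \<and> closed (epi g) \<and> convex (epi g)"

definition subdiff :: "('a::real_inner \<Rightarrow> ereal) \<Rightarrow> 'a \<Rightarrow> 'a set" where
  "subdiff g x = {v. x \<in> edom g \<and> (\<forall>z. g x + ereal (v \<bullet> (z - x)) \<le> g z)}"

definition par :: "'a::real_vector set \<Rightarrow> 'a set" where
  "par S = span {u - v |u v. u \<in> S \<and> v \<in> S}"


section \<open>Self-adjoint operators and set-valued maps\<close>

definition psd :: "('a::real_inner \<Rightarrow> 'a) \<Rightarrow> bool" where
  "psd L \<longleftrightarrow> linear L \<and> (\<forall>x y. L x \<bullet> y = x \<bullet> L y) \<and> (\<forall>x. 0 \<le> x \<bullet> L x)"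

definition posdef :: "('a::real_inner \<Rightarrow> 'a) \<Rightarrow> bool" where
  "posdef L \<longleftrightarrow> linear L \<and> (\<forall>x y. L x \<bullet> y = x \<bullet> L y) \<and> (\<forall>x. x \<noteq> 0 \<longrightarrow> 0 < x \<bullet> L x)"

text \<open>The set $(L + S)^{-1}(z)$ for a single-valued map $L$ and a set-valued map $S$.\<close>

definition inv_sum :: "('a::plus \<Rightarrow> 'a) \<Rightarrow> ('a \<Rightarrow> 'a set) \<Rightarrow> 'a \<Rightarrow> 'a set" where
  "inv_sum L S z = {u. \<exists>s \<in> S u. L u + s = z}"


section \<open>The operators of the method\<close>

definition blockM ::
  "real^'n^'m \<Rightarrow> real^'n^'n \<Rightarrow> real^'m^'m \<Rightarrow> (real^'n) \<times> (real^'m) \<Rightarrow> (real^'n) \<times> (real^'m)" where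
  "blockM A P Q = (\<lambda>(x, y). (P *v x + transpose A *v y, A *v x + Q *v y))"

definition KKT ::
  "(real^'n \<Rightarrow> real) \<Rightarrow> (real^'n \<Rightarrow> ereal) \<Rightarrow> real^'n^'m \<Rightarrow> real^'m \<Rightarrow> real
     \<Rightarrow> (real^'n) \<times> (real^'m) \<Rightarrow> ((real^'n) \<times> (real^'m)) set" where
  "KKT f g A b \<sigma> = (\<lambda>(x, y).
     {(grad f x + v - transpose A *v y + \<sigma> *\<^sub>R (transpose A *v (A *v x - b)), A *v x - b)
      |v. v \<in> subdiff g x})"

definition Wstar ::
  "(real^'n \<Rightarrow> real) \<Rightarrow> (real^'n \<Rightarrow> ereal) \<Rightarrow> real^'n^'m \<Rightarrow> real^'m \<Rightarrow> real
     \<Rightarrow> ((real^'n) \<times> (real^'m)) set" where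
  "Wstar f g A b \<sigma> = {w. 0 \<in> KKT f g A b \<sigma> w}"

definition Bh :: "(real^'n \<Rightarrow> real) \<Rightarrow> (real^'n) \<times> (real^'m) \<Rightarrow> (real^'n) \<times> (real^'m)" where
  "Bh h = (\<lambda>(x, y). (grad h x, 0))"

definition Ah ::
  "(real^'n \<Rightarrow> real) \<Rightarrow> (real^'n \<Rightarrow> ereal) \<Rightarrow> real^'n^'m \<Rightarrow> real^'m \<Rightarrow> real
     \<Rightarrow> (real^'n \<Rightarrow> real) \<Rightarrow> (real^'n) \<times> (real^'m) \<Rightarrow> ((real^'n) \<times> (real^'m)) set" where
  "Ah f g A b \<sigma> h w = {t - Bh h w |t. t \<in> KKT f g A b \<sigma> w}"

text \<open>The two maps are functions obtained from set-valued ones with \<^const>\<open>the_elem\<close>; under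
  \<open>exact_assms\<close> respectively \<open>lin_assms\<close> below, together with the standing assumptions,
  the sets in question are singletons.\<close>

definition exact_map ::
  "(real^'n \<Rightarrow> real) \<Rightarrow> (real^'n \<Rightarrow> ereal) \<Rightarrow> real^'n^'m \<Rightarrow> real^'m \<Rightarrow> real
     \<Rightarrow> real^'n^'n \<Rightarrow> real^'m^'m \<Rightarrow> (real^'n) \<times> (real^'m) \<Rightarrow> (real^'n) \<times> (real^'m)" where
  "exact_map f g A b \<sigma> P Q w =
     the_elem (inv_sum (blockM A P Q) (KKT f g A b \<sigma>) (blockM A P Q w))"

definition lin_map ::
  "(real^'n \<Rightarrow> real) \<Rightarrow> (real^'n \<Rightarrow> ereal) \<Rightarrow> real^'n^'m \<Rightarrow> real^'m \<Rightarrow> real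
     \<Rightarrow> real^'n^'n \<Rightarrow> real^'m^'m \<Rightarrow> (real^'n \<Rightarrow> real)
     \<Rightarrow> (real^'n) \<times> (real^'m) \<Rightarrow> (real^'n) \<times> (real^'m)" where
  "lin_map f g A b \<sigma> P Q h w =
     the_elem (inv_sum (blockM A P Q) (Ah f g A b \<sigma> h) (blockM A P Q w - Bh h w))"

definition exact_assms ::
  "(real^'n \<Rightarrow> real) \<Rightarrow> (real^'n \<Rightarrow> ereal) \<Rightarrow> real^'n^'m \<Rightarrow> real
     \<Rightarrow> real^'n^'n \<Rightarrow> real^'m^'m \<Rightarrow> bool" where
  "exact_assms f g A \<sigma> P Q \<longleftrightarrow>
     posdef ((*v) Q) \<and> psd (blockM A P Q) \<and>
     (\<exists>R L. L-lipschitz_on UNIV R \<and>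
        (\<forall>z. inv_sum (\<lambda>x. P *v x + \<sigma> *\<^sub>R (transpose A *v (A *v x)))
                     (subdiff (\<lambda>x. ereal (f x) + g x)) z = {R z}))"

definition lin_assms ::
  "(real^'n \<Rightarrow> real) \<Rightarrow> real^'n^'m \<Rightarrow> real^'m \<Rightarrow> real
     \<Rightarrow> real^'n^'n \<Rightarrow> real^'m^'m \<Rightarrow> (real^'n \<Rightarrow> real) \<Rightarrow> real \<Rightarrow> bool" where
  "lin_assms f A b \<sigma> P Q h L\<^sub>h \<longleftrightarrow>
     convex_on UNIV h \<and> C1_lipschitz_grad L\<^sub>h h \<and>
     convex_on UNIV (\<lambda>x. f x - h x + \<sigma> / 2 * (norm (A *v x - b))\<^sup>2) \<and>
     posdef ((*v) Q) \<and>
     posdef ((*v) (P - transpose A ** matrix_inv Q ** A))"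


section \<open>Embedded manifolds and partial smoothness\<close>

definition C2_on :: "'a::euclidean_space set \<Rightarrow> ('a \<Rightarrow> 'b::euclidean_space) \<Rightarrow> bool" where
  "C2_on U \<phi> \<longleftrightarrow>
     (\<exists>(\<phi>' :: 'a \<Rightarrow> 'a \<Rightarrow>\<^sub>L 'b) (\<phi>'' :: 'a \<Rightarrow> 'a \<Rightarrow>\<^sub>L ('a \<Rightarrow>\<^sub>L 'b)).
        (\<forall>x\<in>U. (\<phi> has_derivative blinfun_apply (\<phi>' x)) (at x)) \<and>
        (\<forall>x\<in>U. (\<phi>' has_derivative blinfun_apply (\<phi>'' x)) (at x)) \<and>
        continuous_on U \<phi>'')"

text \<open>A $C^2$ embedded submanifold of dimension \<open>k\<close>, by slice charts: near each of its points
  a $C^2$ diffeomorphism between open sets of the ambient space straightens it to a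
  \<open>k\<close>-dimensional linear subspace.\<close>

definition C2_submanifold :: "nat \<Rightarrow> 'a::euclidean_space set \<Rightarrow> bool" where
  "C2_submanifold k M \<longleftrightarrow>
     (\<forall>p\<in>M. \<exists>U V \<phi> \<psi> (S :: 'a set).
        open U \<and> p \<in> U \<and> open V \<and> homeomorphism U V \<phi> \<psi> \<and> C2_on U \<phi> \<and> C2_on V \<psi> \<and>
        subspace S \<and> dim S = k \<and> \<phi> ` (M \<inter> U) = S \<inter> V)"

definition tangent_space :: "'a::euclidean_space set \<Rightarrow> 'a \<Rightarrow> 'a set" where
  "tangent_space M x =
     {v. \<exists>\<gamma> \<epsilon>. 0 < \<epsilon> \<and> \<gamma> C1_differentiable_on {-\<epsilon><..<\<epsilon>} \<and> \<gamma> ` {-\<epsilon><..<\<epsilon>} \<subseteq> M \<and>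
        \<gamma> 0 = x \<and> (\<gamma> has_vector_derivative v) (at 0)}"

text \<open>A function on an embedded submanifold is $C^2$ around \<open>x\<close> when it agrees there with a
  $C^2$ function on an open subset of the ambient space.\<close>

definition C2_restriction_at :: "('a::euclidean_space \<Rightarrow> ereal) \<Rightarrow> 'a set \<Rightarrow> 'a \<Rightarrow> bool" where
  "C2_restriction_at g M x \<longleftrightarrow>
     (\<exists>U G. open U \<and> x \<in> U \<and> C2_on U G \<and> (\<forall>z \<in> M \<inter> U. g z = ereal (G z)))"

definition PK_outer ::
  "('a::topological_space \<Rightarrow> 'b::topological_space set) \<Rightarrow> 'a set \<Rightarrow> 'a \<Rightarrow> 'b set" where
  "PK_outer S M x =
     {u. \<exists>xs us. (\<forall>k. xs k \<in> M) \<and> xs \<longlonglongrightarrow> x \<and> (\<forall>k::nat. us k \<in> S (xs k)) \<and> us \<longlonglongrightarrow> u}"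

definition PK_inner ::
  "('a::topological_space \<Rightarrow> 'b::topological_space set) \<Rightarrow> 'a set \<Rightarrow> 'a \<Rightarrow> 'b set" where
  "PK_inner S M x =
     {u. \<forall>xs. (\<forall>k. xs k \<in> M) \<and> xs \<longlonglongrightarrow> x \<longrightarrow>
           (\<exists>us. (\<forall>\<^sub>F k::nat in sequentially. us k \<in> S (xs k)) \<and> us \<longlonglongrightarrow> u)}"

definition PK_continuous_along ::
  "('a::topological_space \<Rightarrow> 'b::topological_space set) \<Rightarrow> 'a set \<Rightarrow> 'a \<Rightarrow> bool" where
  "PK_continuous_along S M x \<longleftrightarrow> PK_outer S M x \<subseteq> S x \<and> S x \<subseteq> PK_inner S M x"

definition partly_smooth :: "('a::euclidean_space \<Rightarrow> ereal) \<Rightarrow> 'a \<Rightarrow> 'a set \<Rightarrow> bool" where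
  "partly_smooth g x M \<longleftrightarrow>
     x \<in> edom g \<and> x \<in> M \<and> (\<exists>k. C2_submanifold k M) \<and>
     C2_restriction_at g M x \<and>
     tangent_space M x = (par (subdiff g x))\<^sup>\<bottom> \<and>
     PK_continuous_along (subdiff g) M x"

end

theory Submission
  imports Defs
begin

text \<open>Reading off the first block row of the inclusion that defines \<open>F\<close> gives subgradients
  $u^j \in \partial g(\hat x^j)$ that converge to
  $v^\star = A^\top y^\star - \nabla f(x^\star)$, because $A x^\star = b$.

  Suppose that $\hat x^j$ is outside the manifold infinitely often. Let $p^j$ be its projection
  onto the manifold and $n^j$ the unit vector in direction $\hat x^j - p^j$. A cluster point $n$ of
  these normals is normal to the manifold at $x^\star$, hence lies in
  $\operatorname{par} \partial g(x^\star)$, and nondegeneracy gives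
  $v^\star + \varepsilon n \in \partial g(x^\star)$ for some $\varepsilon > 0$. By inner
  semicontinuity along the manifold this vector is a limit of $s^j \in \partial g(p^j)$, and
  monotonicity $\langle u^j - s^j, n^j \rangle \ge 0$ becomes $-\varepsilon \ge 0$ in the limit.\<close>

section \<open>Gradients and subdifferentials\<close>

text \<open>\<open>grad\<close> is a definite description, so a representing vector and its
  uniqueness are both required. The vector is the adjoint of the derivative applied to
  \<open>1\<close>.\<close>

lemma GDERIV_grad:
  fixes f :: "'a::euclidean_space \<Rightarrow> real"
  assumes "f differentiable (at x)"
  shows "GDERIV f x :> grad f x"
proof -
  obtain f' where f': "(f has_derivative f') (at x)"
    using assms by (auto simp: differentiable_def)
  have lin: "linear f'"
    using f' by (rule has_derivative_linear)
  have "f' = (\<lambda>h. h \<bullet> adjoint f' 1)"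
    using adjoint_works[OF lin, of _ 1] by (auto simp: fun_eq_iff)
  with f' have ex: "GDERIV f x :> adjoint f' 1"
    by (simp add: gderiv_def)
  have uniq: "D = adjoint f' 1" if "GDERIV f x :> D" for D
  proof -
    have "(\<lambda>h. h \<bullet> D) = (\<lambda>h. h \<bullet> adjoint f' 1)"
      using that ex unfolding gderiv_def by (rule has_derivative_unique)
    then show ?thesis
      by (simp add: fun_eq_iff vector_eq_ldot)
  qed
  show ?thesis
    unfolding grad_def using ex uniq by (rule theI)
qed

lemma GDERIV_imp_isCont:
  assumes "GDERIV f x :> D"
  shows "isCont f x"
  using assms unfolding gderiv_def by (rule has_derivative_continuous)

text \<open>The right-hand difference quotients along \<open>d\<close> stay above \<open>c\<close>,
  hence so does their limit. This serves both the gradient inequality and the removal of a smooth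
  summand from a subgradient.\<close>

lemma GDERIV_directional_lower:
  fixes f :: "'a::real_inner \<Rightarrow> real"
  assumes D: "GDERIV f x :> D"
    and lower: "\<And>t. 0 < t \<Longrightarrow> t \<le> 1 \<Longrightarrow> f x + t * c \<le> f (x + t *\<^sub>R d)"
  shows "c \<le> D \<bullet> d"
proof -
  have "((\<lambda>t::real. x + t *\<^sub>R d) has_derivative (\<lambda>t. t *\<^sub>R d)) (at 0)"
    by (auto intro!: derivative_eq_intros)
  moreover have "(f has_derivative (\<lambda>h. h \<bullet> D)) (at (x + 0 *\<^sub>R d))"
    using D by (simp add: gderiv_def)
  ultimately have "((\<lambda>t. f (x + t *\<^sub>R d)) has_derivative (\<lambda>t. (t *\<^sub>R d) \<bullet> D)) (at 0)"
    by (rule has_derivative_compose)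
  then have "DERIV (\<lambda>t. f (x + t *\<^sub>R d)) 0 :> D \<bullet> d"
    by (simp add: has_field_derivative_def inner_commute mult_commute_abs)
  then have "((\<lambda>t. (f (x + t *\<^sub>R d) - f x) / t) \<longlongrightarrow> D \<bullet> d) (at_right 0)"
    unfolding has_field_derivative_iff by (auto intro: tendsto_mono at_le)
  moreover have "\<forall>\<^sub>F t in at_right 0. c \<le> (f (x + t *\<^sub>R d) - f x) / t"
    using eventually_at_right_real[OF zero_less_one]
  proof eventually_elim
    case (elim t)
    then show ?case
      using lower[of t] by (simp add: field_simps)
  qed
  ultimately show ?thesis
    by (rule tendsto_lowerbound) simp
qed

lemma convex_on_above_gradient:
  assumes f: "convex_on UNIV f" and D: "GDERIV f x :> D"
  shows "f x + D \<bullet> (z - x) \<le> f z"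
proof -
  \<comment> \<open>Convexity bounds \<open>f\<close> from above along the segment, so the
    directional lemma is applied to \<open>- f\<close>.\<close>
  have "- (f z - f x) \<le> (- D) \<bullet> (z - x)"
  proof (rule GDERIV_directional_lower[OF GDERIV_minus[OF D]])
    fix t :: real
    assume t: "0 < t" "t \<le> 1"
    have "f ((1 - t) *\<^sub>R x + t *\<^sub>R z) \<le> (1 - t) * f x + t * f z"
      using t by (intro convex_onD[OF f]) auto
    then show "- f x + t * - (f z - f x) \<le> - f (x + t *\<^sub>R (z - x))"
      by (simp add: algebra_simps)
  qed
  then show ?thesis
    by simp
qed

lemma convex_on_gradient_mono:
  assumes f: "convex_on UNIV f" and "GDERIV f x :> D" "GDERIV f y :> E"
  shows "0 \<le> (D - E) \<bullet> (x - y)"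
  using convex_on_above_gradient[OF f assms(2), of y] convex_on_above_gradient[OF f assms(3), of x]
  by (simp add: inner_diff_left inner_diff_right)

text \<open>Testing against every real \<open>s\<close> above \<open>g z\<close> makes points with
  \<open>g z = \<infinity>\<close> vacuous, so later arguments involve only real inequalities over
  the epigraph.\<close>

lemma subdiff_iff_epi:
  assumes "\<And>x. g x \<noteq> -\<infinity>"
  shows "v \<in> subdiff g x \<longleftrightarrow>
    (\<exists>r. g x = ereal r \<and> (\<forall>z s. g z \<le> ereal s \<longrightarrow> r + v \<bullet> (z - x) \<le> s))"
proof
  assume v: "v \<in> subdiff g x"
  then have "g x \<noteq> \<infinity>"
    by (auto simp: subdiff_def edom_def)
  with assms[of x] obtain r where r: "g x = ereal r"
    by (cases "g x") auto
  have "r + v \<bullet> (z - x) \<le> s" if "g z \<le> ereal s" for z s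
  proof -
    have "ereal (r + v \<bullet> (z - x)) \<le> g z"
      using v r by (auto simp: subdiff_def)
    with that have "ereal (r + v \<bullet> (z - x)) \<le> ereal s"
      by (rule order_trans[rotated])
    then show ?thesis
      by simp
  qed
  with r show "\<exists>r. g x = ereal r \<and> (\<forall>z s. g z \<le> ereal s \<longrightarrow> r + v \<bullet> (z - x) \<le> s)"
    by blast
next
  assume "\<exists>r. g x = ereal r \<and> (\<forall>z s. g z \<le> ereal s \<longrightarrow> r + v \<bullet> (z - x) \<le> s)"
  then obtain r where r: "g x = ereal r"
    and le: "\<And>z s. g z \<le> ereal s \<Longrightarrow> r + v \<bullet> (z - x) \<le> s"
    by blast
  have "g x + ereal (v \<bullet> (z - x)) \<le> g z" for z
    using le[of z] assms[of z] r by (cases "g z") auto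
  with r show "v \<in> subdiff g x"
    by (auto simp: subdiff_def edom_def)
qed

lemma subdiff_mono:
  assumes "\<And>x. g x \<noteq> -\<infinity>" and "u \<in> subdiff g x" and "v \<in> subdiff g y"
  shows "0 \<le> (u - v) \<bullet> (x - y)"
proof -
  obtain r where r: "g x = ereal r" "\<And>z s. g z \<le> ereal s \<Longrightarrow> r + u \<bullet> (z - x) \<le> s"
    using assms by (auto simp: subdiff_iff_epi)
  obtain s where s: "g y = ereal s" "\<And>z t. g z \<le> ereal t \<Longrightarrow> s + v \<bullet> (z - y) \<le> t"
    using assms by (auto simp: subdiff_iff_epi)
  from r(2)[of y s] s(2)[of x r] r(1) s(1) show ?thesis
    by (simp add: algebra_simps)
qed

text \<open>On the segment from \<open>x\<close> to \<open>z\<close>, convexity of the epigraph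
  bounds \<open>g\<close> by an affine function of \<open>t\<close>. The subgradient inequality of
  the sum then bounds the increments of \<open>f\<close> from below, and \<open>t\<close> tending to
  0 brings in \<open>D\<close>.\<close>

lemma subdiff_smooth_addD:
  assumes g: "\<And>x. g x \<noteq> -\<infinity>" "convex (epi g)"
    and D: "GDERIV f x :> D"
    and v: "v \<in> subdiff (\<lambda>x. ereal (f x) + g x) x"
  shows "v - D \<in> subdiff g x"
proof -
  have fg: "\<And>x. ereal (f x) + g x \<noteq> -\<infinity>"
    using g(1) by simp
  obtain r' where r': "ereal (f x) + g x = ereal r'"
    and le: "\<And>z s. ereal (f z) + g z \<le> ereal s \<Longrightarrow> r' + v \<bullet> (z - x) \<le> s"
    using v unfolding subdiff_iff_epi[of "\<lambda>x. ereal (f x) + g x", OF fg] by blast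
  then obtain r where r: "g x = ereal r" and r'_eq: "r' = f x + r"
    by (cases "g x") auto
  have "r + (v - D) \<bullet> (z - x) \<le> s" if z: "g z \<le> ereal s" for z s
  proof -
    have "r - s + v \<bullet> (z - x) \<le> D \<bullet> (z - x)"
    proof (rule GDERIV_directional_lower[OF D])
      fix t :: real
      assume t: "0 < t" "t \<le> 1"
      have "(1 - t) *\<^sub>R (x, r) + t *\<^sub>R (z, s) \<in> epi g"
        using t z r by (intro convexD_alt[OF g(2)]) (auto simp: epi_def)
      then have "g (x + t *\<^sub>R (z - x)) \<le> ereal ((1 - t) * r + t * s)"
        by (simp add: epi_def algebra_simps)
      then have "ereal (f (x + t *\<^sub>R (z - x))) + g (x + t *\<^sub>R (z - x))
          \<le> ereal (f (x + t *\<^sub>R (z - x)) + ((1 - t) * r + t * s))"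
        by (metis add_left_mono plus_ereal.simps(1))
      from le[OF this] show "f x + t * (r - s + v \<bullet> (z - x)) \<le> f (x + t *\<^sub>R (z - x))"
        by (simp add: r'_eq algebra_simps)
    qed
    then show ?thesis
      by (simp add: algebra_simps)
  qed
  with r show ?thesis
    by (auto simp: subdiff_iff_epi[OF g(1)])
qed

text \<open>The remaining direction adds the gradient inequality of the convex \<open>f\<close>. The
  equivalence turns the hypothesis of \<open>exact_assms\<close> on the sum \<open>f + g\<close>
  into an inclusion for \<open>g\<close> alone.\<close>

lemma subdiff_smooth_add:
  assumes g: "\<And>x. g x \<noteq> -\<infinity>" "convex (epi g)"
    and f: "convex_on UNIV f" and D: "GDERIV f x :> D"
  shows "v \<in> subdiff (\<lambda>x. ereal (f x) + g x) x \<longleftrightarrow> v - D \<in> subdiff g x"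
proof
  assume "v - D \<in> subdiff g x"
  then obtain r where r: "g x = ereal r"
    and le: "\<And>z s. g z \<le> ereal s \<Longrightarrow> r + (v - D) \<bullet> (z - x) \<le> s"
    using g by (auto simp: subdiff_iff_epi)
  have "f x + r + v \<bullet> (z - x) \<le> s" if "ereal (f z) + g z \<le> ereal s" for z s
  proof -
    have "g z \<le> ereal (s - f z)"
      using that by (cases "g z") auto
    from le[OF this] convex_on_above_gradient[OF f D, of z] show ?thesis
      by (simp add: algebra_simps)
  qed
  moreover have "\<And>x. ereal (f x) + g x \<noteq> -\<infinity>"
    using g(1) by simp
  ultimately show "v \<in> subdiff (\<lambda>x. ereal (f x) + g x) x"
    using r by (subst subdiff_iff_epi) auto
qed (rule subdiff_smooth_addD[OF g D])

text \<open>Existence by the direct method: the affine minorant of \<open>g\<close> given by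
  \<open>v\<close> and the quadratic growth of \<open>k\<close> make a sublevel set of
  \<open>k + g\<close> bounded. Fermat's rule holds at a minimiser, and the smooth summand is then
  removed.\<close>

lemma ex_neg_gradient_in_subdiff:
  fixes k :: "'a::euclidean_space \<Rightarrow> real"
  assumes g: "proper_closed_convex g"
    and K: "\<And>x. GDERIV k x :> K x"
    and v: "v \<in> subdiff g x0" and "0 < c"
    and growth: "\<And>z. k x0 + d \<bullet> (z - x0) + c * (norm (z - x0))\<^sup>2 \<le> k z"
  shows "\<exists>x. - K x \<in> subdiff g x"
proof -
  have g': "\<And>x. g x \<noteq> -\<infinity>" "closed (epi g)" "convex (epi g)"
    using g by (auto simp: proper_closed_convex_def)
  have cont: "continuous_on UNIV k"
    using K by (meson GDERIV_imp_isCont continuous_at_imp_continuous_on)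
  obtain r0 where r0: "g x0 = ereal r0"
    and le: "\<And>z s. g z \<le> ereal s \<Longrightarrow> r0 + v \<bullet> (z - x0) \<le> s"
    using v g' by (auto simp: subdiff_iff_epi)
  \<comment> \<open>Minimising \<open>k z + s\<close> over points \<open>(z, s)\<close> of the closed epigraph replaces
    minimising the extended-valued function \<open>k + g\<close>.\<close>
  define S where "S = epi g \<inter> {p. k (fst p) + snd p \<le> k x0 + r0}"
  \<comment> \<open>On \<open>S\<close>, minorant and growth combine to \<open>c * (norm (z -
    x0))\<^sup>2 \<le> norm (d + v) * norm (z - x0)\<close>, which gives this radius.\<close>
  define \<rho> where "\<rho> = norm (d + v) / c"
  have cont_S: "continuous_on X (\<lambda>p :: 'a \<times> real. k (fst p) + snd p)" for X
    by (intro continuous_intros continuous_on_compose2[OF cont]) auto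
  have bound: "z \<in> cball x0 \<rho> \<and> s \<in> {r0 - norm v * \<rho>..r0 + norm d * \<rho>}"
    if "(z, s) \<in> S" for z s
  proof -
    have gz: "g z \<le> ereal s" and kz: "k z + s \<le> k x0 + r0"
      using that by (auto simp: S_def epi_def)
    have "c * (norm (z - x0))\<^sup>2 \<le> - ((d + v) \<bullet> (z - x0))"
      using le[OF gz] kz growth[of z] by (simp add: algebra_simps)
    also have "\<dots> \<le> norm (d + v) * norm (z - x0)"
      using Cauchy_Schwarz_ineq2[of "d + v" "z - x0"] by linarith
    finally have "(c * norm (z - x0)) * norm (z - x0) \<le> norm (d + v) * norm (z - x0)"
      by (simp add: power2_eq_square)
    then have "c * norm (z - x0) \<le> norm (d + v)"
      by (cases "z = x0") auto
    then have \<rho>: "norm (z - x0) \<le> \<rho>"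
      using \<open>0 < c\<close> by (simp add: \<rho>_def field_simps)
    have "\<bar>v \<bullet> (z - x0)\<bar> \<le> norm v * \<rho>" "\<bar>d \<bullet> (z - x0)\<bar> \<le> norm d * \<rho>"
      using \<rho> by (meson Cauchy_Schwarz_ineq2 mult_left_mono norm_ge_zero order_trans)+
    moreover have "0 \<le> c * (norm (z - x0))\<^sup>2"
      using \<open>0 < c\<close> by simp
    ultimately show ?thesis
      using \<rho> le[OF gz] kz growth[of z] by (auto simp: dist_norm norm_minus_commute)
  qed
  have "compact S"
  proof (rule compact_eq_bounded_closed[THEN iffD2], rule conjI)
    have "S \<subseteq> cball x0 \<rho> \<times> {r0 - norm v * \<rho>..r0 + norm d * \<rho>}"
      using bound by auto
    then show "bounded S"
      by (rule bounded_subset[rotated]) (intro bounded_Times bounded_cball bounded_closed_interval)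
    show "closed S"
      unfolding S_def by (intro closed_Int g' closed_Collect_le cont_S continuous_on_const)
  qed
  moreover have "(x0, r0) \<in> S"
    using r0 by (simp add: S_def epi_def)
  ultimately obtain p where p: "p \<in> S"
    and min: "\<And>q. q \<in> S \<Longrightarrow> k (fst p) + snd p \<le> k (fst q) + snd q"
    using continuous_attains_inf[of S "\<lambda>p. k (fst p) + snd p"] cont_S by blast
  obtain x r where x: "p = (x, r)"
    by (cases p)
  \<comment> \<open>Epigraph points outside \<open>S\<close> have a value above that of
    \<open>(x0, r0)\<close>, hence above that of \<open>p\<close>.\<close>
  have min': "k x + r \<le> k z + s" if "g z \<le> ereal s" for z s
    using min[of "(z, s)"] p that x
    by (cases "k z + s \<le> k x0 + r0") (auto simp: S_def epi_def)
  have "g x \<le> ereal r"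
    using p x by (simp add: S_def epi_def)
  \<comment> \<open>The minimiser lies on the graph: lowering \<open>r\<close> to \<open>g x\<close>
    stays in the epigraph and would otherwise decrease the objective.\<close>
  then have gx: "g x = ereal r"
    using min'[of x "real_of_ereal (g x)"] g'(1)[of x] by (cases "g x") auto
  have "\<And>x. ereal (k x) + g x \<noteq> -\<infinity>"
    using g'(1) by simp
  moreover have "k x + r \<le> s" if "ereal (k z) + g z \<le> ereal s" for z s
    using min'[of z "s - k z"] that by (cases "g z") auto
  ultimately have "0 \<in> subdiff (\<lambda>x. ereal (k x) + g x) x"
    using gx by (subst subdiff_iff_epi) auto
  from subdiff_smooth_addD[OF g'(1,3) K this] show ?thesis
    by auto
qed


section \<open>Projections onto embedded manifolds\<close>

lemma C2_submanifold_chart: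
  fixes M :: "'a::euclidean_space set"
  assumes "C2_submanifold k M" "x \<in> M"
  obtains U V \<phi> \<psi> and S :: "'a set"
  where "open U" "x \<in> U" "open V" "homeomorphism U V \<phi> \<psi>" "C2_on U \<phi>" "C2_on V \<psi>"
    "subspace S" "\<phi> ` (M \<inter> U) = S \<inter> V"
proof -
  obtain U V \<phi> \<psi> and S :: "'a set" where "open U \<and> x \<in> U \<and> open V \<and> homeomorphism U V \<phi> \<psi> \<and>
      C2_on U \<phi> \<and> C2_on V \<psi> \<and> subspace S \<and> dim S = k \<and> \<phi> ` (M \<inter> U) = S \<inter> V"
    using assms(1)[unfolded C2_submanifold_def, rule_format, OF assms(2)] by (elim exE)
  then show thesis
    using that[of U V \<phi> \<psi> S] by simp
qed

text \<open>Within a chart domain the manifold is the preimage of a closed subspace, hence closed in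
  a small closed ball. Nearest points are taken in this compact piece, since \<open>M\<close> itself
  is not assumed closed.\<close>

lemma C2_submanifold_local_compact:
  fixes M :: "'a::euclidean_space set"
  assumes M: "C2_submanifold k M" and x: "x \<in> M"
  obtains r where "0 < r" "compact (M \<inter> cball x r)"
proof -
  obtain U V \<phi> \<psi> and S :: "'a set" where U: "open U" "x \<in> U"
    and hom: "homeomorphism U V \<phi> \<psi>" and S: "subspace S" "\<phi> ` (M \<inter> U) = S \<inter> V"
    using C2_submanifold_chart[OF M x] by metis
  obtain r where r: "0 < r" "cball x r \<subseteq> U"
    using U open_contains_cball by blast
  have "y \<in> M \<longleftrightarrow> \<phi> y \<in> S" if "y \<in> U" for y
  proof
    assume "\<phi> y \<in> S"
    then have "\<phi> y \<in> \<phi> ` (M \<inter> U)"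
      using S that hom by (auto simp: homeomorphism_def)
    then obtain m where m: "m \<in> M" "m \<in> U" "\<phi> y = \<phi> m"
      by auto
    have "y = \<psi> (\<phi> y)"
      using homeomorphism_apply1[OF hom that] by (rule sym)
    also have "\<dots> = m"
      unfolding m(3) using homeomorphism_apply1[OF hom m(2)] .
    finally show "y \<in> M"
      using m(1) by (rule ssubst)
  qed (use S that in blast)
  then have "M \<inter> cball x r = cball x r \<inter> \<phi> -` S"
    using r by auto
  moreover have "continuous_on (cball x r) \<phi>"
    using hom r(2) by (auto simp: homeomorphism_def intro: continuous_on_subset)
  ultimately have "closed (M \<inter> cball x r)"
    by (metis S(1) closed_cball closed_subspace continuous_closed_preimage)
  then have "compact (M \<inter> cball x r)"
    by (simp add: compact_eq_bounded_closed bounded_Int)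
  with r(1) show thesis
    by (rule that)
qed

text \<open>First-order condition for a nearest point. Writing tangent directions as
  \<open>\<psi>' s\<close> with \<open>s\<close> in the fixed subspace \<open>S\<close> lets the
  condition pass to limits when the base point \<open>p\<close> moves.\<close>

lemma normal_of_nearest_in_chart:
  fixes M :: "'a::euclidean_space set"
  assumes hom: "homeomorphism U V \<phi> \<psi>" and V: "open V"
    and S: "subspace S" "\<phi> ` (M \<inter> U) = S \<inter> V"
    and \<psi>': "(\<psi> has_derivative \<psi>') (at (\<phi> p))"
    and p: "p \<in> M" "p \<in> U" "p \<in> ball x r"
    and nearest: "\<And>q. q \<in> M \<inter> cball x r \<Longrightarrow> dist z p \<le> dist z q"
    and s: "s \<in> S"
  shows "(z - p) \<bullet> \<psi>' s = 0"
proof -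
  \<comment> \<open>A curve in \<open>M\<close> through \<open>p\<close>: the squared distance to \<open>z\<close> along it is minimal at \<open>p\<close>.\<close>
  define c where "c t = \<psi> (\<phi> p + t *\<^sub>R s)" for t :: real
  have c0: "c 0 = p"
    using hom p by (simp add: c_def homeomorphism_apply1)
  have "((\<lambda>t::real. \<phi> p + t *\<^sub>R s) has_derivative (\<lambda>t. t *\<^sub>R s)) (at 0)"
    by (auto intro!: derivative_eq_intros)
  moreover have "(\<psi> has_derivative \<psi>') (at (\<phi> p + 0 *\<^sub>R s))"
    using \<psi>' by simp
  ultimately have "(c has_derivative (\<lambda>t. \<psi>' (t *\<^sub>R s))) (at 0)"
    unfolding c_def by (rule has_derivative_compose)
  moreover have "linear \<psi>'"
    using \<psi>' by (rule has_derivative_linear)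
  ultimately have c': "(c has_derivative (\<lambda>t. t *\<^sub>R \<psi>' s)) (at 0)"
    by (simp add: linear_cmul)
  have "\<forall>\<^sub>F t in nhds 0. \<phi> p + t *\<^sub>R s \<in> V"
  proof -
    have "((\<lambda>t::real. \<phi> p + t *\<^sub>R s) \<longlongrightarrow> \<phi> p + 0 *\<^sub>R s) (nhds 0)"
      by (intro tendsto_intros filterlim_ident)
    moreover have "\<phi> p \<in> V"
      using hom p by (auto simp: homeomorphism_def)
    ultimately show ?thesis
      using V by (auto dest: topological_tendstoD)
  qed
  \<comment> \<open>Minimality is known only within \<open>cball x r\<close>; as \<open>p\<close>
    lies in the open ball, nearby curve points are admissible competitors.\<close>
  moreover have "\<forall>\<^sub>F t in nhds 0. c t \<in> ball x r"
  proof -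
    have "isCont c 0"
      using c' by (rule has_derivative_continuous)
    then have "(c \<longlongrightarrow> p) (nhds 0)"
      by (metis c0 isCont_def tendsto_at_iff_tendsto_nhds)
    then show ?thesis
      using p(3) by (auto dest: topological_tendstoD)
  qed
  ultimately have "\<forall>\<^sub>F t in nhds 0. (z - c 0) \<bullet> (z - c 0) \<le> (z - c t) \<bullet> (z - c t)"
  proof eventually_elim
    case (elim t)
    have "\<phi> p \<in> S"
      using p S(2) by blast
    then have "\<phi> p + t *\<^sub>R s \<in> S \<inter> V"
      using S(1) s elim(1) by (simp add: subspace_add subspace_scale)
    then obtain m where "m \<in> M \<inter> U" "\<phi> p + t *\<^sub>R s = \<phi> m"
      using S(2) by (metis imageE)
    then have "c t \<in> M"
      using hom by (simp add: c_def homeomorphism_apply1)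
    then have "dist z p \<le> dist z (c t)"
      using nearest elim(2) by simp
    then show ?case
      by (simp add: c0 dist_norm norm_le)
  qed
  then obtain T where T: "open T" "0 \<in> T"
    "\<And>t. t \<in> T \<Longrightarrow> (z - c 0) \<bullet> (z - c 0) \<le> (z - c t) \<bullet> (z - c t)"
    unfolding eventually_nhds by blast
  have "((\<lambda>t. (z - c t) \<bullet> (z - c t)) has_derivative
      (\<lambda>t. - 2 * t * ((z - p) \<bullet> \<psi>' s))) (at 0)"
    by (auto intro!: derivative_eq_intros c' simp: c0 inner_commute algebra_simps)
  from differential_zero_maxmin[OF T(2,1) this] T(3)
  have "(\<lambda>t. - 2 * t * ((z - p) \<bullet> \<psi>' s)) = (\<lambda>t. 0)"
    by blast
  from fun_cong[OF this, of 1] show ?thesis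
    by simp
qed

text \<open>The chart sends a curve in \<open>M\<close> into \<open>S\<close>. Its product with any
  \<open>y\<close> orthogonal to \<open>S\<close> vanishes near 0, so the velocity lies in the
  double orthogonal complement of \<open>S\<close>, which is \<open>S\<close>.\<close>

lemma tangent_space_chart:
  fixes M :: "'a::euclidean_space set" and \<phi> :: "'a \<Rightarrow> 'b::euclidean_space"
  assumes U: "open U" "x \<in> U"
    and S: "subspace S" "\<phi> ` (M \<inter> U) \<subseteq> S"
    and \<phi>': "(\<phi> has_derivative \<phi>') (at x)"
    and v: "v \<in> tangent_space M x"
  shows "\<phi>' v \<in> S"
proof -
  obtain \<gamma> \<epsilon> where \<epsilon>: "0 < \<epsilon>" "\<gamma> ` {-\<epsilon><..<\<epsilon>} \<subseteq> M" "\<gamma> 0 = x"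
    and \<gamma>': "(\<gamma> has_vector_derivative v) (at 0)"
    using v by (auto simp: tangent_space_def)
  have "(\<gamma> \<longlongrightarrow> \<gamma> 0) (at 0)"
    using has_vector_derivative_continuous[OF \<gamma>'] by (simp add: isCont_def)
  then have "\<forall>\<^sub>F t in at 0. \<gamma> t \<in> U"
    using U \<epsilon> by (auto dest: topological_tendstoD)
  then have "\<forall>\<^sub>F t in nhds 0. \<gamma> t \<in> U"
    using U(2) \<epsilon>(3) unfolding eventually_at_filter by (auto elim: eventually_mono)
  moreover have "\<forall>\<^sub>F t in nhds 0. t \<in> {-\<epsilon><..<\<epsilon>}"
    using \<epsilon>(1) by (intro eventually_nhds_in_open) auto
  ultimately have in_S: "\<forall>\<^sub>F t in nhds 0. \<phi> (\<gamma> t) \<in> S"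
    by eventually_elim (use \<epsilon>(2) S(2) in blast)
  have "(\<phi> has_derivative \<phi>') (at (\<gamma> 0))"
    using \<phi>' \<epsilon> by simp
  with \<gamma>' have deriv: "((\<lambda>t. \<phi> (\<gamma> t)) has_derivative (\<lambda>t. \<phi>' (t *\<^sub>R v))) (at 0)"
    unfolding has_vector_derivative_def by (rule has_derivative_compose)
  have "orthogonal y (\<phi>' v)" if y: "y \<in> S\<^sup>\<bottom>" for y
  proof -
    have "((\<lambda>t. y \<bullet> \<phi> (\<gamma> t)) has_derivative (\<lambda>t. y \<bullet> \<phi>' (t *\<^sub>R v))) (at 0)"
      by (intro derivative_intros deriv)
    moreover have "((\<lambda>t. y \<bullet> \<phi> (\<gamma> t)) has_derivative (\<lambda>t. 0)) (at 0)"
    proof (rule has_derivative_transform_eventually[OF has_derivative_const[of 0]])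
      have *: "\<forall>\<^sub>F t in nhds 0. 0 = y \<bullet> \<phi> (\<gamma> t)"
        using in_S y by (auto elim!: eventually_mono
            simp: orthogonal_comp_def orthogonal_def inner_commute)
      then show "\<forall>\<^sub>F t in at 0. 0 = y \<bullet> \<phi> (\<gamma> t)"
        by (simp add: eventually_at_filter eventually_mono)
      show "0 = y \<bullet> \<phi> (\<gamma> 0)"
        using * by (rule eventually_nhds_x_imp_x)
    qed simp
    ultimately have "(\<lambda>t. y \<bullet> \<phi>' (t *\<^sub>R v)) = (\<lambda>t. 0)"
      by (rule has_derivative_unique)
    from fun_cong[OF this, of 1] show ?thesis
      by (simp add: orthogonal_def)
  qed
  then have "\<phi>' v \<in> S\<^sup>\<bottom>\<^sup>\<bottom>"
    by (simp add: orthogonal_comp_def)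
  with S(1) show ?thesis
    by (simp add: orthogonal_comp_self)
qed

text \<open>Each \<open>n j\<close> annihilates the tangent vector
  \<open>\<psi>' (\<phi> (p j)) (\<phi>' v)\<close> at \<open>p j\<close>. Continuity of
  \<open>\<psi>'\<close> makes these vectors converge to \<open>v\<close>, so the limit
  \<open>l\<close> annihilates \<open>v\<close>.\<close>

lemma limit_of_normals:
  fixes M :: "'a::euclidean_space set"
  assumes M: "C2_submanifold k M" "x \<in> M" and "0 < r"
    and p: "\<And>j. p j \<in> M" "p \<longlonglongrightarrow> x"
    and nearest: "\<And>j q. q \<in> M \<inter> cball x r \<Longrightarrow> dist (z j) (p j) \<le> dist (z j) q"
    and n: "\<And>j. n j = c j *\<^sub>R (z j - p j)" "n \<longlonglongrightarrow> l"
  shows "l \<in> (tangent_space M x)\<^sup>\<bottom>"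
proof -
  obtain U V \<phi> \<psi> and S :: "'a set" where U: "open U" "x \<in> U" and V: "open V"
    and hom: "homeomorphism U V \<phi> \<psi>" and S: "subspace S" "\<phi> ` (M \<inter> U) = S \<inter> V"
    and C2: "C2_on U \<phi>" "C2_on V \<psi>"
    using C2_submanifold_chart[OF M] by metis
  obtain \<phi>' where \<phi>': "(\<phi> has_derivative blinfun_apply \<phi>') (at x)"
    using C2(1) U(2) unfolding C2_on_def by blast
  obtain \<psi>' :: "'a \<Rightarrow> 'a \<Rightarrow>\<^sub>L 'a" and \<psi>'' :: "'a \<Rightarrow> 'a \<Rightarrow>\<^sub>L ('a \<Rightarrow>\<^sub>L 'a)"
    where \<psi>': "\<And>y. y \<in> V \<Longrightarrow> (\<psi> has_derivative blinfun_apply (\<psi>' y)) (at y)"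
      and \<psi>'': "\<And>y. y \<in> V \<Longrightarrow> (\<psi>' has_derivative blinfun_apply (\<psi>'' y)) (at y)"
    using C2(2) unfolding C2_on_def by blast
  have \<phi>V: "\<phi> y \<in> V" if "y \<in> U" for y
    using hom that by (auto simp: homeomorphism_def)
  have p_near: "\<forall>\<^sub>F j in sequentially. p j \<in> U \<inter> ball x r"
    using U \<open>0 < r\<close> by (intro topological_tendstoD[OF p(2)]) auto
  have "isCont \<phi> x"
    using \<phi>' by (rule has_derivative_continuous)
  then have "(\<lambda>j. \<phi> (p j)) \<longlonglongrightarrow> \<phi> x"
    using p(2) by (rule isCont_tendsto_compose)
  moreover have "isCont \<psi>' (\<phi> x)"
    using \<psi>''[OF \<phi>V[OF U(2)]] by (rule has_derivative_continuous)
  ultimately have \<psi>'_lim: "(\<lambda>j. \<psi>' (\<phi> (p j))) \<longlonglongrightarrow> \<psi>' (\<phi> x)"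
    by (rule isCont_tendsto_compose[rotated])
  have "orthogonal v l" if v: "v \<in> tangent_space M x" for v
  proof -
    have s: "\<phi>' v \<in> S"
      using tangent_space_chart[OF U S(1) _ \<phi>' v] S(2) by simp
    \<comment> \<open>The derivatives of the chart and its inverse are inverse to each other, by the
      chain rule for \<open>\<psi> (\<phi> y) = y\<close>.\<close>
    have "((\<lambda>y. \<psi> (\<phi> y)) has_derivative (\<lambda>h. \<psi>' (\<phi> x) (\<phi>' h))) (at x)"
      using \<phi>' \<psi>'[OF \<phi>V[OF U(2)]] by (rule has_derivative_compose)
    moreover have "((\<lambda>y. \<psi> (\<phi> y)) has_derivative (\<lambda>h. h)) (at x)"
      by (rule has_derivative_transform_within_open[OF has_derivative_ident U])
        (use hom in \<open>simp add: homeomorphism_apply1\<close>)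
    ultimately have "(\<lambda>h. \<psi>' (\<phi> x) (\<phi>' h)) = (\<lambda>h. h)"
      by (rule has_derivative_unique)
    then have v_eq: "\<psi>' (\<phi> x) (\<phi>' v) = v"
      by (rule fun_cong)
    have "\<forall>\<^sub>F j in sequentially. n j \<bullet> \<psi>' (\<phi> (p j)) (\<phi>' v) = 0"
      using p_near
    proof eventually_elim
      case (elim j)
      have "(z j - p j) \<bullet> \<psi>' (\<phi> (p j)) (\<phi>' v) = 0"
        using elim \<psi>'[OF \<phi>V] s nearest p(1)
        by (intro normal_of_nearest_in_chart[OF hom V S, where x=x and r=r]) auto
      then show ?case
        by (simp add: n(1))
    qed
    then have "(\<lambda>j. n j \<bullet> \<psi>' (\<phi> (p j)) (\<phi>' v)) \<longlonglongrightarrow> 0"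
      by (rule tendsto_eventually)
    moreover have "(\<lambda>j. n j \<bullet> \<psi>' (\<phi> (p j)) (\<phi>' v)) \<longlonglongrightarrow> l \<bullet> \<psi>' (\<phi> x) (\<phi>' v)"
      by (intro tendsto_intros n(2) \<psi>'_lim)
    ultimately show ?thesis
      using LIMSEQ_unique v_eq by (force simp: orthogonal_def inner_commute)
  qed
  then show ?thesis
    by (simp add: orthogonal_comp_def)
qed


section \<open>Finite identification\<close>

text \<open>\<open>par C\<close> is contained in the direction space of the affine hull, so a short
  enough step along \<open>n\<close> stays in the hull and in the ball around
  \<open>v\<close>.\<close>

lemma rel_interior_add_par:
  fixes C :: "'a::euclidean_space set"
  assumes v: "v \<in> rel_interior C" and n: "n \<in> par C"
  obtains e where "0 < e" "v + e *\<^sub>R n \<in> C"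
proof -
  obtain \<delta> where vC: "v \<in> C" and \<delta>: "0 < \<delta>" "ball v \<delta> \<inter> affine hull C \<subseteq> C"
    using v by (auto simp: mem_rel_interior_ball)
  have hull: "affine hull C = (\<lambda>x. v + x) ` span ((\<lambda>x. - v + x) ` C)"
    using vC by (intro affine_hull_span_gen hull_inc)
  have "par C \<subseteq> span ((\<lambda>x. - v + x) ` C)"
    unfolding par_def
  proof (rule span_minimal)
    show "{u - w |u w. u \<in> C \<and> w \<in> C} \<subseteq> span ((\<lambda>x. - v + x) ` C)"
    proof clarify
      fix u w
      assume "u \<in> C" "w \<in> C"
      then have "(- v + u) - (- v + w) \<in> span ((\<lambda>x. - v + x) ` C)"
        by (intro span_diff span_base imageI)
      then show "u - w \<in> span ((\<lambda>x. - v + x) ` C)"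
        by simp
    qed
  qed simp
  with n have nspan: "n \<in> span ((\<lambda>x. - v + x) ` C)"
    by blast
  \<comment> \<open>The summand 1 covers \<open>n = 0\<close> and makes the step strictly shorter
    than \<open>\<delta>\<close>.\<close>
  define e where "e = \<delta> / (norm n + 1)"
  have pos: "0 < norm n + 1"
    by (simp add: add_nonneg_pos)
  have e: "0 < e" "norm n * e < \<delta>"
    using \<delta>(1) pos by (simp_all add: e_def pos_divide_less_eq algebra_simps)
  then have "v + e *\<^sub>R n \<in> ball v \<delta>"
    by (simp add: dist_norm mult.commute)
  moreover have "v + e *\<^sub>R n \<in> affine hull C"
    unfolding hull using nspan by (intro imageI span_scale)
  ultimately have "v + e *\<^sub>R n \<in> C"
    using \<delta>(2) by blast
  with e(1) show thesis
    by (rule that)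
qed

text \<open>Asking for a single index means that the contrary assumption puts every
  \<open>z j\<close> outside \<open>M\<close>, so all normals are defined. The lemma is meant to be
  applied to subsequences.\<close>

lemma partly_smooth_identification_frequently:
  fixes g :: "'a::euclidean_space \<Rightarrow> ereal"
  assumes g: "\<And>x. g x \<noteq> -\<infinity>" and ps: "partly_smooth g x M"
    and ri: "v \<in> rel_interior (subdiff g x)"
    and z: "z \<longlonglongrightarrow> x" and u: "u \<longlonglongrightarrow> v" and sub: "\<And>j. u j \<in> subdiff g (z j)"
  shows "\<exists>j. z j \<in> M"
proof (rule ccontr)
  assume "\<nexists>j. z j \<in> M"
  then have out: "z j \<notin> M" for j
    by blast
  obtain k where M: "C2_submanifold k M" and x: "x \<in> M"
    and tan: "tangent_space M x = (par (subdiff g x))\<^sup>\<bottom>"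
    and inner: "subdiff g x \<subseteq> PK_inner (subdiff g) M x"
    using ps by (auto simp: partly_smooth_def PK_continuous_along_def)
  obtain r where r: "0 < r" "compact (M \<inter> cball x r)"
    using C2_submanifold_local_compact[OF M x] .
  have "M \<inter> cball x r \<noteq> {}"
    using x r(1) by auto
  then have "\<exists>p\<in>M \<inter> cball x r. \<forall>q\<in>M \<inter> cball x r. dist (z j) p \<le> dist (z j) q" for j
    using distance_attains_inf[OF compact_imp_closed[OF r(2)], of "z j"] by metis
  then obtain p where p: "\<And>j. p j \<in> M \<inter> cball x r"
    and nearest: "\<And>j q. q \<in> M \<inter> cball x r \<Longrightarrow> dist (z j) (p j) \<le> dist (z j) q"
    by metis
  \<comment> \<open>The point \<open>x\<close> itself competes in the projection, and the triangle
    inequality then costs a factor 2.\<close>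
  have p_lim: "p \<longlonglongrightarrow> x"
  proof -
    have "dist (p j) x \<le> 2 * dist (z j) x" for j
    proof -
      have "dist (z j) (p j) \<le> dist (z j) x"
        using nearest x r(1) by simp
      then show ?thesis
        using dist_triangle[of "p j" x "z j"] by (simp add: dist_commute)
    qed
    moreover have "(\<lambda>j. 2 * dist (z j) x) \<longlonglongrightarrow> 2 * 0"
      using z by (intro tendsto_mult tendsto_const) (rule tendsto_dist_iff[THEN iffD1])
    ultimately show ?thesis
      using tendsto_sandwich[of "\<lambda>_. 0" "\<lambda>j. dist (p j) x" sequentially "\<lambda>j. 2 * dist (z j) x" 0]
      by (subst tendsto_dist_iff) auto
  qed
  define n where "n j = (1 / norm (z j - p j)) *\<^sub>R (z j - p j)" for j
  have ne: "z j \<noteq> p j" for j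
    using out[of j] p[of j] by auto
  then have "norm (n j) = 1" for j
    by (simp add: n_def)
  then have "\<forall>j. n j \<in> sphere 0 1"
    by simp
  then obtain l \<theta> where l: "l \<in> sphere 0 1" and \<theta>: "strict_mono \<theta>" "(n \<circ> \<theta>) \<longlonglongrightarrow> l"
    using compact_sphere[of 0 1] unfolding compact_def by metis
  have p_lim': "(\<lambda>j. p (\<theta> j)) \<longlonglongrightarrow> x" and u_lim': "(\<lambda>j. u (\<theta> j)) \<longlonglongrightarrow> v"
    using LIMSEQ_subseq_LIMSEQ[OF p_lim \<theta>(1)] LIMSEQ_subseq_LIMSEQ[OF u \<theta>(1)]
    by (auto simp: o_def)
  have "l \<in> (tangent_space M x)\<^sup>\<bottom>"
  proof (rule limit_of_normals[OF M x r(1), where p="\<lambda>j. p (\<theta> j)" and z="\<lambda>j. z (\<theta> j)"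
        and n="n \<circ> \<theta>" and c="\<lambda>j. 1 / norm (z (\<theta> j) - p (\<theta> j))"])
    show "(n \<circ> \<theta>) j = (1 / norm (z (\<theta> j) - p (\<theta> j))) *\<^sub>R (z (\<theta> j) - p (\<theta> j))" for j
      by (simp add: n_def)
  qed (use p p_lim' nearest \<theta> in auto)
  \<comment> \<open>A span is a subspace and so equals its double orthogonal complement.\<close>
  also have "\<dots> = par (subdiff g x)"
    unfolding tan by (simp add: par_def orthogonal_comp_self)
  finally obtain e where e: "0 < e" "v + e *\<^sub>R l \<in> subdiff g x"
    using rel_interior_add_par[OF ri] by blast
  then have "v + e *\<^sub>R l \<in> PK_inner (subdiff g) M x"
    using inner by blast
  then obtain s where s: "\<forall>\<^sub>F j in sequentially. s j \<in> subdiff g (p (\<theta> j))" "s \<longlonglongrightarrow> v + e *\<^sub>R l"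
    using p p_lim' unfolding PK_inner_def by fast
  have "\<forall>\<^sub>F j in sequentially. 0 \<le> (u (\<theta> j) - s j) \<bullet> n (\<theta> j)"
    using s(1)
  proof eventually_elim
    case (elim j)
    have "0 \<le> (u (\<theta> j) - s j) \<bullet> (z (\<theta> j) - p (\<theta> j))"
      using subdiff_mono[OF g sub elim] .
    then show ?case
      by (simp add: n_def)
  qed
  moreover have "(\<lambda>j. (u (\<theta> j) - s j) \<bullet> n (\<theta> j)) \<longlonglongrightarrow> (v - (v + e *\<^sub>R l)) \<bullet> l"
    using \<theta>(2) by (intro tendsto_intros u_lim' s(2)) (simp add: o_def)
  ultimately have "0 \<le> (v - (v + e *\<^sub>R l)) \<bullet> l"
    by (intro tendsto_lowerbound) auto
  moreover have "l \<bullet> l = 1"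
    using l by (simp add: norm_eq_1)
  ultimately show False
    using e(1) by simp
qed

text \<open>If infinitely many \<open>z j\<close> were outside \<open>M\<close>, they would form a
  subsequence lying entirely outside, contradicting the previous lemma.\<close>

lemma partly_smooth_identification:
  fixes g :: "'a::euclidean_space \<Rightarrow> ereal"
  assumes g: "\<And>x. g x \<noteq> -\<infinity>" and ps: "partly_smooth g x M"
    and ri: "v \<in> rel_interior (subdiff g x)"
    and z: "z \<longlonglongrightarrow> x" and u: "u \<longlonglongrightarrow> v" and sub: "\<And>j. u j \<in> subdiff g (z j)"
  shows "\<forall>\<^sub>F j in sequentially. z j \<in> M"
proof (rule ccontr)
  assume "\<not> ?thesis"
  then have "\<exists>\<^sub>F j in sequentially. z j \<notin> M"
    by (simp add: not_eventually)
  then have "infinite {j. z j \<notin> M}"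
    unfolding cofinite_eq_sequentially[symmetric] frequently_cofinite .
  then obtain \<theta> :: "nat \<Rightarrow> nat" where \<theta>: "strict_mono \<theta>" "\<And>j. z (\<theta> j) \<notin> M"
    using infinite_enumerate by blast
  have "(\<lambda>j. z (\<theta> j)) \<longlonglongrightarrow> x" "(\<lambda>j. u (\<theta> j)) \<longlonglongrightarrow> v"
    using LIMSEQ_subseq_LIMSEQ[OF z \<theta>(1)] LIMSEQ_subseq_LIMSEQ[OF u \<theta>(1)] by (auto simp: o_def)
  then have "\<exists>j. z (\<theta> j) \<in> M"
    by (intro partly_smooth_identification_frequently[OF g ps ri _ _ sub])
  with \<theta>(2) show False
    by blast
qed


section \<open>The exact and the linearized map\<close>

text \<open>Keeps products as \<open>transpose A *v y\<close>, the form used by the operators,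
  rather than \<open>y v* A\<close>.\<close>

declare transpose_matrix_vector [simp del]

text \<open>The constant is the minimum of the quadratic form on the compact unit sphere;
  homogeneity extends the bound to all vectors.\<close>

lemma posdef_imp_coercive:
  fixes L :: "'a::euclidean_space \<Rightarrow> 'a"
  assumes L: "posdef L"
  obtains c where "0 < c" "\<And>x. c * (norm x)\<^sup>2 \<le> x \<bullet> L x"
proof -
  have lin: "linear L" and pos: "\<And>x. x \<noteq> 0 \<Longrightarrow> 0 < x \<bullet> L x"
    using L by (auto simp: posdef_def)
  obtain b :: 'a where "b \<in> Basis"
    using nonempty_Basis by blast
  then have "sphere (0::'a) 1 \<noteq> {}"
    by (auto intro!: exI[of _ b])
  moreover have "continuous_on (sphere 0 1) (\<lambda>x. x \<bullet> L x)"
    by (intro continuous_intros linear_continuous_on linear_conv_bounded_linear[THEN iffD1] lin)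
  ultimately obtain u where u: "u \<in> sphere 0 1"
    and min: "\<And>x. x \<in> sphere 0 1 \<Longrightarrow> u \<bullet> L u \<le> x \<bullet> L x"
    using continuous_attains_inf[OF compact_sphere, of 0 1 "\<lambda>x. x \<bullet> L x"] by blast
  have "(u \<bullet> L u) * (norm x)\<^sup>2 \<le> x \<bullet> L x" for x
  proof (cases "x = 0")
    case False
    have "u \<bullet> L u \<le> (x /\<^sub>R norm x) \<bullet> L (x /\<^sub>R norm x)"
      using False by (intro min) simp
    also have "\<dots> = (x \<bullet> L x) / (norm x)\<^sup>2"
      using False by (simp add: linear_cmul[OF lin] power2_eq_square divide_inverse)
    finally show ?thesis
      using False by (simp add: pos_le_divide_eq)
  qed simp
  moreover have "u \<noteq> 0"
    using u by auto
  ultimately show thesis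
    using that pos by blast
qed

lemma posdef_imp_bij:
  fixes L :: "'a::euclidean_space \<Rightarrow> 'a"
  assumes "posdef L"
  shows "bij L"
proof -
  have lin: "linear L" and pos: "\<And>x. x \<noteq> 0 \<Longrightarrow> 0 < x \<bullet> L x"
    using assms by (auto simp: posdef_def)
  have "inj L"
    unfolding linear_injective_0[OF lin]
  proof (intro allI impI)
    fix x
    assume "L x = 0"
    then show "x = 0"
      using pos[of x] by (cases "x = 0") auto
  qed
  then show ?thesis
    using linear_injective_imp_surjective[OF lin] by (simp add: bij_def)
qed

lemma inner_transpose_matrix:
  fixes A :: "real^'n^'m"
  shows "x \<bullet> (transpose A *v y) = (A *v x) \<bullet> y"
  using dot_lmul_matrix[of y A x] by (simp add: transpose_matrix_vector inner_commute)

text \<open>With \<open>y\<close> solving \<open>Q *v y = A *v x\<close>, the form of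
  \<open>P\<close> at \<open>x\<close> is the form of the Schur complement at \<open>x\<close> plus
  the form of \<open>Q\<close> at \<open>y\<close>.\<close>

lemma posdef_Schur_complement:
  fixes A :: "real^'n^'m"
  assumes P: "psd ((*v) P)" and Q: "posdef ((*v) Q)"
    and schur: "posdef ((*v) (P - transpose A ** matrix_inv Q ** A))"
  shows "posdef ((*v) P)"
proof -
  have "0 < x \<bullet> (P *v x)" if "x \<noteq> 0" for x
  proof -
    define y where "y = matrix_inv Q *v (A *v x)"
    have "\<exists>B. B ** Q = mat 1"
      using posdef_imp_bij[OF Q] by (simp add: matrix_left_invertible_injective bij_def)
    then have "invertible Q"
      by (simp add: invertible_left_inverse)
    then have "Q ** matrix_inv Q = mat 1"
      unfolding invertible_def matrix_inv_def by (rule someI_ex[THEN conjunct1])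
    then have Qy: "Q *v y = A *v x"
      by (simp add: y_def matrix_vector_mul_assoc matrix_mul_assoc)
    have "0 \<le> y \<bullet> (Q *v y)"
      using Q by (cases "y = 0") (auto simp: posdef_def less_imp_le)
    moreover have "(P - transpose A ** matrix_inv Q ** A) *v x = P *v x - transpose A *v y"
      by (simp add: y_def matrix_vector_mult_diff_rdistrib matrix_vector_mul_assoc
          matrix_mul_assoc)
    moreover have "0 < x \<bullet> ((P - transpose A ** matrix_inv Q ** A) *v x)"
      using schur that by (simp add: posdef_def)
    ultimately show ?thesis
      by (simp add: inner_diff_right inner_transpose_matrix Qy inner_commute)
  qed
  then show ?thesis
    using P by (simp add: psd_def posdef_def)
qed

text \<open>This provides single-valuedness of the linearized map. Existence comes from a strongly
  convex minimisation, uniqueness from monotonicity of all three terms, strict for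
  \<open>L\<close>.\<close>

lemma ex1_strongly_monotone_inclusion:
  fixes L :: "'a::euclidean_space \<Rightarrow> 'a"
  assumes L: "posdef L" and g: "proper_closed_convex g"
    and k: "convex_on UNIV k" "\<And>x. GDERIV k x :> K x"
    and v: "v \<in> subdiff g x0"
  shows "\<exists>!x. c - L x - K x \<in> subdiff g x"
proof (rule ex_ex1I)
  have lin: "linear L" and sym: "\<And>x y. L x \<bullet> y = x \<bullet> L y" and pos: "\<And>x. x \<noteq> 0 \<Longrightarrow> 0 < x \<bullet> L x"
    using L by (auto simp: posdef_def)
  obtain e where e: "0 < e" "\<And>x. e * (norm x)\<^sup>2 \<le> x \<bullet> L x"
    using posdef_imp_coercive[OF L] by blast
  \<comment> \<open>The inclusion is the optimality condition for minimising \<open>q + g\<close>.\<close>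
  define q where "q x = x \<bullet> L x / 2 - c \<bullet> x + k x" for x
  have q': "GDERIV q x :> L x - c + K x" for x
  proof -
    have "(L has_derivative L) (at x)"
      using lin by (simp add: linear_conv_bounded_linear bounded_linear_imp_has_derivative)
    moreover have "(k has_derivative (\<lambda>h. h \<bullet> K x)) (at x)"
      using k(2) by (simp add: gderiv_def)
    ultimately have "(q has_derivative (\<lambda>h. (x \<bullet> L h + h \<bullet> L x) / 2 - c \<bullet> h + h \<bullet> K x)) (at x)"
      unfolding q_def by (auto intro!: derivative_eq_intros)
    moreover have "(x \<bullet> L h + h \<bullet> L x) / 2 - c \<bullet> h + h \<bullet> K x = h \<bullet> (L x - c + K x)" for h
      using sym[of x h] by (simp add: inner_add_right inner_diff_right inner_commute)
    ultimately show ?thesis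
      by (simp add: gderiv_def)
  qed
  \<comment> \<open>The quadratic part expands exactly around \<open>x0\<close>, and
    \<open>k\<close> contributes its gradient inequality. The growth constant is
    \<open>e / 2\<close> because \<open>q\<close> contains half the quadratic form.\<close>
  have "q x0 + (L x0 - c + K x0) \<bullet> (z - x0) + (e / 2) * (norm (z - x0))\<^sup>2 \<le> q z" for z
  proof -
    have "z \<bullet> L z = x0 \<bullet> L x0 + 2 * (L x0 \<bullet> (z - x0)) + (z - x0) \<bullet> L (z - x0)"
      using sym[of x0 z] inner_commute[of z "L x0"] inner_commute[of x0 "L x0"]
      unfolding linear_diff[OF lin] inner_diff_left inner_diff_right by simp
    then show ?thesis
      using e(2)[of "z - x0"] convex_on_above_gradient[OF k, of x0 z]
      by (simp add: q_def inner_diff_left inner_diff_right inner_add_left field_simps)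
  qed
  from ex_neg_gradient_in_subdiff[OF g q' v _ this] e(1)
  show "\<exists>x. c - L x - K x \<in> subdiff g x"
    by (simp add: diff_diff_eq add.commute)
  show "x = y" if x: "c - L x - K x \<in> subdiff g x" and y: "c - L y - K y \<in> subdiff g y" for x y
  proof (rule ccontr)
    assume "x \<noteq> y"
    then have "0 < L (x - y) \<bullet> (x - y)"
      using pos[of "x - y"] by (simp add: inner_commute)
    moreover have "0 \<le> ((c - L x - K x) - (c - L y - K y)) \<bullet> (x - y)"
      using g by (intro subdiff_mono[OF _ x y]) (simp add: proper_closed_convex_def)
    moreover have "0 \<le> (K x - K y) \<bullet> (x - y)"
      by (rule convex_on_gradient_mono[OF k(1) k(2) k(2)])
    ultimately show False
      by (simp add: linear_diff[OF lin] inner_diff_left)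
  qed
qed

section \<open>Solving the block inclusions of the two maps\<close>

lemma mem_inv_sum_iff:
  fixes z :: "'a::ab_group_add"
  shows "u \<in> inv_sum L S z \<longleftrightarrow> z - L u \<in> S u"
  by (auto simp: inv_sum_def intro: bexI[of _ "z - L u"])

text \<open>The terms \<open>transpose A *v y\<close> of the two operators cancel, so the first row
  is an inclusion in \<open>x\<close> alone; the second row then determines \<open>y\<close> because
  \<open>Q\<close> is bijective. The singleton form is what evaluates
  \<open>the_elem\<close>.\<close>

lemma inv_sum_blockM_singleton:
  fixes A :: "real^'n^'m"
  assumes Q: "posdef ((*v) Q)"
    and T: "\<And>x y. T (x, y) = {(a x + v - transpose A *v y, A *v x - b) |v. v \<in> G x}"
    and ex1: "\<exists>!x. c - P *v x - a x \<in> G x"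
  obtains x y where "inv_sum (blockM A P Q) T (c, d) = {(x, y)}" "c - P *v x - a x \<in> G x"
proof -
  obtain x where x: "c - P *v x - a x \<in> G x" and x_uniq: "\<And>x'. c - P *v x' - a x' \<in> G x' \<Longrightarrow> x' = x"
    using ex1 by blast
  obtain y where y: "Q *v y = d + b - A *v x - A *v x"
    using posdef_imp_bij[OF Q] by (metis bij_pointE)
  have y_uniq: "y' = y" if "Q *v y' = Q *v y" for y'
    using posdef_imp_bij[OF Q] that by (simp add: bij_def inj_eq)
  have mem: "(x', y') \<in> inv_sum (blockM A P Q) T (c, d) \<longleftrightarrow>
      c - P *v x' - a x' \<in> G x' \<and> Q *v y' = d + b - A *v x' - A *v x'" for x' y'
  proof -
    have "(x', y') \<in> inv_sum (blockM A P Q) T (c, d) \<longleftrightarrow>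
        (\<exists>v. c - (P *v x' + transpose A *v y') = a x' + v - transpose A *v y' \<and>
          d - (A *v x' + Q *v y') = A *v x' - b \<and> v \<in> G x')"
      by (simp add: mem_inv_sum_iff blockM_def T)
    moreover have "c - (P *v x' + transpose A *v y') = a x' + v - transpose A *v y' \<longleftrightarrow>
        v = c - P *v x' - a x'" for v
      by (auto simp: algebra_simps)
    moreover have "d - (A *v x' + Q *v y') = A *v x' - b \<longleftrightarrow>
        Q *v y' = d + b - A *v x' - A *v x'"
      by (auto simp: algebra_simps)
    ultimately show ?thesis
      by (simp only:) blast
  qed
  have "inv_sum (blockM A P Q) T (c, d) = {(x, y)}"
  proof (rule set_eqI)
    fix p :: "(real^'n) \<times> (real^'m)"
    obtain x' y' where p: "p = (x', y')"
      by (cases p)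
    show "p \<in> inv_sum (blockM A P Q) T (c, d) \<longleftrightarrow> p \<in> {(x, y)}"
      unfolding p mem using x y x_uniq[of x'] y_uniq[of y'] by auto
  qed
  then show thesis
    using x by (rule that)
qed

text \<open>The resolvent hypothesis gives the unique solution of the first row; the asserted
  subgradient is that row solved for its element of \<open>subdiff g x'\<close>.\<close>

lemma exact_map_subgradient:
  fixes A :: "real^'n^'m"
  assumes g: "proper_closed_convex g"
    and f: "convex_on UNIV f" "\<And>x. f differentiable (at x)"
    and ex: "exact_assms f g A \<sigma> P Q"
    and u: "exact_map f g A b \<sigma> P Q (x, y) = (x', y')"
  shows "P *v x + transpose A *v y - P *v x'
      - (grad f x' + \<sigma> *\<^sub>R (transpose A *v (A *v x' - b))) \<in> subdiff g x'"
proof -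
  have g': "\<And>x. g x \<noteq> -\<infinity>" "convex (epi g)"
    using g by (auto simp: proper_closed_convex_def)
  obtain R where R: "\<And>z. inv_sum (\<lambda>x. P *v x + \<sigma> *\<^sub>R (transpose A *v (A *v x)))
      (subdiff (\<lambda>x. ereal (f x) + g x)) z = {R z}"
    using ex by (auto simp: exact_assms_def)
  define c where "c = P *v x + transpose A *v y"
  define a where "a x = grad f x + \<sigma> *\<^sub>R (transpose A *v (A *v x - b))" for x
  \<comment> \<open>The operator in \<open>exact_assms\<close> has no \<open>b\<close>, so the
    constant part of the penalty gradient moves into the argument.\<close>
  define z where "z = c + \<sigma> *\<^sub>R (transpose A *v b)"
  have "c - P *v u - a u \<in> subdiff g u \<longleftrightarrow> u = R z" for u
  proof -
    have "u = R z \<longleftrightarrow> u \<in> inv_sum (\<lambda>x. P *v x + \<sigma> *\<^sub>R (transpose A *v (A *v x)))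
        (subdiff (\<lambda>x. ereal (f x) + g x)) z"
      by (simp add: R)
    also have "\<dots> \<longleftrightarrow> z - (P *v u + \<sigma> *\<^sub>R (transpose A *v (A *v u)))
        \<in> subdiff (\<lambda>x. ereal (f x) + g x) u"
      by (rule mem_inv_sum_iff)
    also have "\<dots> \<longleftrightarrow> z - (P *v u + \<sigma> *\<^sub>R (transpose A *v (A *v u))) - grad f u \<in> subdiff g u"
      by (rule subdiff_smooth_add[OF g' f(1) GDERIV_grad[OF f(2)]])
    also have "z - (P *v u + \<sigma> *\<^sub>R (transpose A *v (A *v u))) - grad f u = c - P *v u - a u"
      by (simp add: z_def a_def matrix_vector_mult_diff_distrib scaleR_diff_right)
    finally show ?thesis
      by simp
  qed
  then have ex1: "\<exists>!u. c - P *v u - a u \<in> subdiff g u"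
    by simp
  have Q: "posdef ((*v) Q)"
    using ex by (simp add: exact_assms_def)
  have T: "KKT f g A b \<sigma> (x, y) =
      {(a x + v - transpose A *v y, A *v x - b) |v. v \<in> subdiff g x}" for x y
    unfolding KKT_def a_def by (auto simp: algebra_simps)
  obtain p q
    where "inv_sum (blockM A P Q) (KKT f g A b \<sigma>) (c, A *v x + Q *v y) = {(p, q)}"
      and "c - P *v p - a p \<in> subdiff g p"
    by (rule inv_sum_blockM_singleton[OF Q T ex1])
  moreover have "blockM A P Q (x, y) = (c, A *v x + Q *v y)"
    by (simp add: blockM_def c_def)
  ultimately show ?thesis
    using u by (simp add: exact_map_def a_def c_def)
qed

text \<open>The first row is governed by \<open>P\<close>, positive definite by the Schur
  complement, and by the gradient of the function that \<open>lin_assms\<close> makes convex. The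
  given \<open>v\<close> is the starting point for existence.\<close>

lemma lin_map_subgradient:
  fixes A :: "real^'n^'m"
  assumes g: "proper_closed_convex g" and v: "v \<in> subdiff g x0" and P: "psd ((*v) P)"
    and f: "\<And>x. f differentiable (at x)"
    and lin: "lin_assms f A b \<sigma> P Q h L\<^sub>h"
    and u: "lin_map f g A b \<sigma> P Q h (x, y) = (x', y')"
  shows "P *v x + transpose A *v y - grad h x - P *v x'
      - (grad f x' - grad h x' + \<sigma> *\<^sub>R (transpose A *v (A *v x' - b))) \<in> subdiff g x'"
proof -
  define c where "c = P *v x + transpose A *v y - grad h x"
  define a where "a x = grad f x - grad h x + \<sigma> *\<^sub>R (transpose A *v (A *v x - b))" for x
  have Q: "posdef ((*v) Q)" and h: "\<And>x. h differentiable (at x)"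
    and k: "convex_on UNIV (\<lambda>x. f x - h x + \<sigma> / 2 * (norm (A *v x - b))\<^sup>2)"
    using lin by (auto simp: lin_assms_def C1_lipschitz_grad_def)
  have "posdef ((*v) P)"
    using lin by (intro posdef_Schur_complement[OF P Q, of A]) (simp add: lin_assms_def)
  moreover have "GDERIV (\<lambda>x. f x - h x + \<sigma> / 2 * (norm (A *v x - b))\<^sup>2) x :> a x" for x
  proof -
    have "((*v) A has_derivative (*v) A) (at x)"
      by (simp add: bounded_linear_imp_has_derivative matrix_vector_mul_bounded_linear)
    then have "((\<lambda>x. \<sigma> / 2 * ((A *v x - b) \<bullet> (A *v x - b))) has_derivative
        (\<lambda>h. h \<bullet> (\<sigma> *\<^sub>R (transpose A *v (A *v x - b))))) (at x)"
      by (auto intro!: derivative_eq_intros simp: inner_transpose_matrix inner_commute)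
    then show ?thesis
      unfolding a_def power2_norm_eq_inner
      by (intro GDERIV_add GDERIV_diff GDERIV_grad f h) (simp add: gderiv_def)
  qed
  ultimately have ex1: "\<exists>!u. c - P *v u - a u \<in> subdiff g u"
    by (intro ex1_strongly_monotone_inclusion[OF _ g k _ v])
  have T: "Ah f g A b \<sigma> h (x, y) =
      {(a x + v - transpose A *v y, A *v x - b) |v. v \<in> subdiff g x}" for x y
  proof -
    have "Ah f g A b \<sigma> h (x, y) = (\<lambda>t. t - Bh h (x, y)) ` KKT f g A b \<sigma> (x, y)"
      by (auto simp: Ah_def)
    also have "KKT f g A b \<sigma> (x, y) = (\<lambda>v. (grad f x + v - transpose A *v y
        + \<sigma> *\<^sub>R (transpose A *v (A *v x - b)), A *v x - b)) ` subdiff g x"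
      by (auto simp: KKT_def)
    also have "(\<lambda>t. t - Bh h (x, y)) ` \<dots> =
        (\<lambda>v. (a x + v - transpose A *v y, A *v x - b)) ` subdiff g x"
      unfolding image_image by (intro image_cong) (simp_all add: Bh_def a_def algebra_simps)
    finally show ?thesis
      by (simp add: Setcompr_eq_image)
  qed
  obtain p q
    where "inv_sum (blockM A P Q) (Ah f g A b \<sigma> h) (c, A *v x + Q *v y) = {(p, q)}"
      and "c - P *v p - a p \<in> subdiff g p"
    by (rule inv_sum_blockM_singleton[OF Q T ex1])
  moreover have "blockM A P Q (x, y) - Bh h (x, y) = (c, A *v x + Q *v y)"
    by (simp add: blockM_def Bh_def c_def)
  ultimately show ?thesis
    using u by (simp add: lin_map_def a_def c_def)
qed

section \<open>Identification along the images of both maps\<close>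

lemma tendsto_matrix_vector_mult:
  fixes A :: "real^'n^'m"
  assumes "(f \<longlongrightarrow> l) F"
  shows "((\<lambda>x. A *v f x) \<longlongrightarrow> A *v l) F"
  using assms by (rule bounded_linear.tendsto[OF matrix_vector_mul_bounded_linear])

theorem theorem4:
  fixes A :: "real^'n^'m" and b :: "real^'m" and \<sigma> :: real
    and f :: "real^'n \<Rightarrow> real" and g :: "real^'n \<Rightarrow> ereal"
    and P :: "real^'n^'n" and Q :: "real^'m^'m"
    and F :: "(real^'n) \<times> (real^'m) \<Rightarrow> (real^'n) \<times> (real^'m)"
    and w what :: "nat \<Rightarrow> (real^'n) \<times> (real^'m)"
    and xstar :: "real^'n" and ystar :: "real^'m"
    and Mg :: "(real^'n) set"
  assumes "0 \<le> \<sigma>"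
    and "convex_on UNIV f" and "\<exists>L. C1_lipschitz_grad L f"
    and "proper_closed_convex g"
    and "psd ((*v) P)" and "psd ((*v) Q)"
    and "(exact_assms f g A \<sigma> P Q \<and> F = exact_map f g A b \<sigma> P Q) \<or>
         (\<exists>h L\<^sub>h. lin_assms f A b \<sigma> P Q h L\<^sub>h \<and> F = lin_map f g A b \<sigma> P Q h)"
    and "\<And>j. what j = F (w j)"
    and "w \<longlonglongrightarrow> (xstar, ystar)" and "what \<longlonglongrightarrow> (xstar, ystar)"
    and "(xstar, ystar) \<in> Wstar f g A b \<sigma>"
    and "partly_smooth g xstar Mg"
    and "transpose A *v ystar - grad f xstar \<in> rel_interior (subdiff g xstar)"
  shows "\<exists>J\<^sub>i\<^sub>d. \<forall>j\<ge>J\<^sub>i\<^sub>d. fst (what j) \<in> Mg"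
proof -
  note g = assms(4) and F = assms(7) and what = assms(8) and ri = assms(13)
  define x y x' y' where "x j = fst (w j)" and "y j = snd (w j)"
    and "x' j = fst (what j)" and "y' j = snd (what j)" for j
  have lims: "x \<longlonglongrightarrow> xstar" "y \<longlonglongrightarrow> ystar" "x' \<longlonglongrightarrow> xstar"
    using tendsto_fst[OF assms(9)] tendsto_snd[OF assms(9)] tendsto_fst[OF assms(10)]
    by (simp_all add: x_def[abs_def] y_def[abs_def] x'_def[abs_def])
  have F_xy: "F (x j, y j) = (x' j, y' j)" for j
    using what[of j] by (simp add: x_def y_def x'_def y'_def)
  have feas: "A *v xstar = b"
    using assms(11) by (auto simp: Wstar_def KKT_def zero_prod_def)
  have grad_lim: "(\<lambda>j. grad k (s j)) \<longlonglongrightarrow> grad k l" if "C1_lipschitz_grad L k" "s \<longlonglongrightarrow> l"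
    for L and k :: "real^'n \<Rightarrow> real" and s l
    using that continuous_on_tendsto_compose[of UNIV "grad k" s l]
    by (auto simp: C1_lipschitz_grad_def)
  obtain L where L: "C1_lipschitz_grad L f"
    using assms(3) by blast
  then have f': "f differentiable (at z)" for z
    by (simp add: C1_lipschitz_grad_def)
  \<comment> \<open>The sequence is read off the first block row. In its limit the \<open>P\<close>
    terms cancel, as do the gradients of \<open>h\<close> in the linearized case, and
    \<open>feas\<close> removes the penalty term.\<close>
  have "\<exists>u. u \<longlonglongrightarrow> transpose A *v ystar - grad f xstar \<and> (\<forall>j. u j \<in> subdiff g (x' j))"
    using F
  proof (elim disjE exE conjE)
    assume ex: "exact_assms f g A \<sigma> P Q" and "F = exact_map f g A b \<sigma> P Q"
    then have "P *v x j + transpose A *v y j - P *v x' j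
        - (grad f (x' j) + \<sigma> *\<^sub>R (transpose A *v (A *v x' j - b))) \<in> subdiff g (x' j)" for j
      using F_xy by (intro exact_map_subgradient[OF g assms(2) f' ex]) simp
    moreover have "(\<lambda>j. P *v x j + transpose A *v y j - P *v x' j
        - (grad f (x' j) + \<sigma> *\<^sub>R (transpose A *v (A *v x' j - b))))
      \<longlonglongrightarrow> P *v xstar + transpose A *v ystar - P *v xstar
        - (grad f xstar + \<sigma> *\<^sub>R (transpose A *v (A *v xstar - b)))"
      by (intro tendsto_intros tendsto_matrix_vector_mult grad_lim[OF L] lims)
    ultimately show ?thesis
      by (auto simp: feas)
  next
    fix h L\<^sub>h
    assume lin: "lin_assms f A b \<sigma> P Q h L\<^sub>h" and "F = lin_map f g A b \<sigma> P Q h"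
    have C1: "C1_lipschitz_grad L\<^sub>h h"
      using lin by (simp add: lin_assms_def)
    \<comment> \<open>Nondegeneracy also supplies the subgradient at \<open>xstar\<close> from which
      the existence argument starts.\<close>
    have "P *v x j + transpose A *v y j - grad h (x j) - P *v x' j
        - (grad f (x' j) - grad h (x' j) + \<sigma> *\<^sub>R (transpose A *v (A *v x' j - b)))
      \<in> subdiff g (x' j)" for j
      using \<open>F = _\<close> F_xy rel_interior_subset ri
      by (intro lin_map_subgradient[OF g _ assms(5) f' lin]) auto
    moreover have "(\<lambda>j. P *v x j + transpose A *v y j - grad h (x j) - P *v x' j
        - (grad f (x' j) - grad h (x' j) + \<sigma> *\<^sub>R (transpose A *v (A *v x' j - b))))
      \<longlonglongrightarrow> P *v xstar + transpose A *v ystar - grad h xstar - P *v xstar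
        - (grad f xstar - grad h xstar + \<sigma> *\<^sub>R (transpose A *v (A *v xstar - b)))"
      by (intro tendsto_intros tendsto_matrix_vector_mult grad_lim[OF L] grad_lim[OF C1] lims)
    ultimately show ?thesis
      by (auto simp: feas)
  qed
  then obtain u where "u \<longlonglongrightarrow> transpose A *v ystar - grad f xstar" "\<And>j. u j \<in> subdiff g (x' j)"
    by blast
  moreover have "\<And>z. g z \<noteq> -\<infinity>"
    using g by (simp add: proper_closed_convex_def)
  ultimately have "\<forall>\<^sub>F j in sequentially. x' j \<in> Mg"
    by (intro partly_smooth_identification[OF _ assms(12) ri lims(3)])
  then show ?thesis
    by (simp add: eventually_sequentially x'_def)
qed

end
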